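(* Let $X$ be a compact Hausdorff space and let $\{f_n\}_{n=0}^{\infty}$ be a standard frame in a Hilbert $C(X)$-module $H$. Let $\theta_{f_n}:H\to C(X,H^2(\mathbb{D}))$, $\theta_{f_n}f=\sum_{n=0}^\infty\langle f,f_n\rangle w^n$, be its analysis operator. Suppose that $$\operatorname{Im}\theta_{f_n}=[b^x(w)C(X,H^2(\mathbb{D}))]^{\perp},$$ where for each $x\in X$, $b^x(w)$ is either an inner function with $b^x(0)=0$ or $b^x(w)=0$, and the family of measures $\{\mu_x\}_{x\in X}$ corresponding to these functions via the Herglotz theorem is weakly continuous. Then there is a bounded linear operator $T:H\to H$ such that $Tf_n=f_{n+1}$ for all $n\ge0$.
   Context: A Hilbert $C(X)$-module is a complex vector space and $C(X)$-module $H$ with a $C(X)$-valued inner product, $C(X)$-linear in the first variable, conjugate symmetric and positive definite, complete in the norm $\|f\|=\sqrt{\|\langle f,f\rangle\|_{C(X)}}$. A standard frame is a sequence $\{f_n\}\subseteq H$ for which there are constants $a,b>0$ with $a\langle f,f\rangle\le\sum_{n=0}^\infty\langle f,f_n\rangle\langle f_n,f\rangle\le b\langle f,f\rangle$ for all $f\in H$, the sum converging in the norm of $C(X)$. $H^2(\mathbb{D})$ is the Hardy space of functions $\sum_{n\ge0}a_nw^n$ on the unit disk $\mathbb{D}$ with $\sum|a_n|^2<\infty$ (norm $(\sum|a_n|^2)^{1/2}$); $C(X,H^2(\mathbb{D}))$ is the Hilbert $C(X)$-module of norm-continuous functions $X\to H^2(\mathbb{D})$ with pointwise inner product; $\sum_n\langle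 f,f_n\rangle w^n$ denotes the function $x\mapsto\sum_n\langle f,f_n\rangle(x)w^n$. An inner function is a bounded analytic $b$ on $\mathbb{D}$ with $\|bf\|_{H^2(\mathbb{D})}=\|f\|_{H^2(\mathbb{D})}$ for all $f\in H^2(\mathbb{D})$. Herglotz theorem: Borel probability measures $\mu$ on $[0,1)$ correspond one-to-one to analytic functions $b$ on $\mathbb{D}$ bounded by one with $b(0)=0$ via $\frac{1+b(w)}{1-b(w)}=\int_0^1\frac{1+we^{-2\pi i y}}{1-we^{-2\pi i y}}\,d\mu(y)$; singular measures (with respect to Lebesgue measure) correspond to inner functions vanishing at $0$, and Lebesgue measure to $b=0$. The family $\{\mu_x\}$ is weakly continuous if $x\mapsto\int_0^1g\,d\mu_x$ is continuous for every $g\in C_b([0,1))$. $[b^x(w)C(X,H^2(\mathbb{D}))]^\perp$ is the set of $h\in C(X,H^2(\mathbb{D}))$ such that $\langle h(x),b^x f(x)\rangle_{H^2(\mathbb{D})}=0$ for all $x\in X$ and all $f\in C(X,H^2(\mathbb{D}))$. *)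

theory Defs
  imports "HOL-Probability.Probability" "HOL-Library.Complex_Order"
begin

section \<open>The algebra C(X)\<close>

text \<open>
  For compact \<open>X\<close> every continuous function is bounded, so \<open>C(X)\<close> with the supremum norm is the
  library type \<open>'x \<Rightarrow>\<^sub>C complex\<close>. The library equips this type only with its Banach space
  structure; the pointwise product is added here.
\<close>

unbundle bcontfun.lifting

instantiation bcontfun :: (topological_space, real_normed_field) comm_ring_1
begin

lift_definition one_bcontfun :: "'a \<Rightarrow>\<^sub>C 'b" is "\<lambda>_. 1"
  by (rule const_bcontfun)

lift_definition times_bcontfun :: "('a \<Rightarrow>\<^sub>C 'b) \<Rightarrow> ('a \<Rightarrow>\<^sub>C 'b) \<Rightarrow> 'a \<Rightarrow>\<^sub>C 'b" is "\<lambda>f g x. f x * g x"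
proof -
  fix f g :: "'a \<Rightarrow> 'b"
  assume f: "f \<in> bcontfun" and g: "g \<in> bcontfun"
  from f obtain B where B: "\<And>x. norm (f x) \<le> B"
    by (auto simp: bcontfun_def bounded_iff)
  from g obtain C where C: "\<And>x. norm (g x) \<le> C"
    by (auto simp: bcontfun_def bounded_iff)
  have "norm (f x * g x) \<le> B * C" for x
    unfolding norm_mult by (intro mult_mono B C order_trans[OF norm_ge_zero B] norm_ge_zero)
  moreover have "continuous_on UNIV (\<lambda>x. f x * g x)"
    using f g by (auto simp: bcontfun_def intro: continuous_on_mult)
  ultimately show "(\<lambda>x. f x * g x) \<in> bcontfun"
    by (rule bcontfun_normI[rotated])
qed

instance
proof
  fix a b c :: "'a \<Rightarrow>\<^sub>C 'b"
  show "a * b * c = a * (b * c)" by transfer (simp add: mult.assoc)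
  show "a * b = b * a" by transfer (simp add: mult.commute)
  show "1 * a = a" by transfer simp
  show "(a + b) * c = a * c + b * c" by transfer (simp add: distrib_right)
  show "(0 :: 'a \<Rightarrow>\<^sub>C 'b) \<noteq> 1" by transfer (simp add: fun_eq_iff)
qed

end

section \<open>Hilbert modules and standard frames\<close>

text \<open>
  The complex scalars act as the constant functions of \<open>C(X)\<close>, and the real scalars of the
  class \<open>banach\<close> are the restriction of the complex ones. Completeness in the
  norm given by the inner product is the class \<open>banach\<close> together with \<open>norm_eq\<close>.
  The order on \<open>complex\<close> is the one of Complex Order: \<open>0 \<le> z\<close> means that \<open>z\<close> is real and
  nonnegative.
\<close>

locale hilbert_CX_module =
  fixes scaleC :: "complex \<Rightarrow> 'h::banach \<Rightarrow> 'h"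
    and act :: "('x::topological_space \<Rightarrow>\<^sub>C complex) \<Rightarrow> 'h \<Rightarrow> 'h"
    and inner_CX :: "'h \<Rightarrow> 'h \<Rightarrow> ('x \<Rightarrow>\<^sub>C complex)"
  assumes vector_space: "vector_space scaleC"
    and module: "module act"
    and scaleC_eq_act: "scaleC c u = act (const_bcontfun c) u"
    and scaleR_eq_scaleC: "r *\<^sub>R u = scaleC (complex_of_real r) u"
    and inner_add_left: "inner_CX (u + v) w = inner_CX u w + inner_CX v w"
    and inner_act_left: "inner_CX (act g u) v = g * inner_CX u v"
    and inner_commute: "inner_CX u v x = cnj (inner_CX v u x)"
    and inner_nonneg: "0 \<le> inner_CX u u x"
    and inner_definite: "inner_CX u u = 0 \<Longrightarrow> u = 0"
    and norm_eq: "norm u = sqrt (norm (inner_CX u u))"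
begin

text \<open>\<open>sums\<close> refers to the norm of \<open>C(X)\<close>, and the order of \<open>C(X)\<close> is the pointwise one.\<close>

definition standard_frame :: "(nat \<Rightarrow> 'h) \<Rightarrow> bool" where
  "standard_frame e \<longleftrightarrow> (\<exists>a>0. \<exists>b>0. \<forall>f. \<exists>S.
     (\<lambda>n. inner_CX f (e n) * inner_CX (e n) f) sums S \<and>
     (\<forall>x. complex_of_real a * inner_CX f f x \<le> S x \<and>
          S x \<le> complex_of_real b * inner_CX f f x))"

definition bounded_operator :: "('h \<Rightarrow> 'h) \<Rightarrow> bool" where
  "bounded_operator T \<longleftrightarrow> bounded_linear T \<and> (\<forall>c u. T (scaleC c u) = scaleC c (T u))"

end

section \<open>The Hardy space on the unit disk\<close>

text \<open>
  Elements of the Hardy space are functions on the unit disk. They are extended by \<open>0\<close> to the whole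
  complex plane, so that equality on the disk is equality in \<open>complex \<Rightarrow> complex\<close>.
\<close>

definition disk_series :: "(nat \<Rightarrow> complex) \<Rightarrow> complex \<Rightarrow> complex" where
  "disk_series a w = (if w \<in> ball 0 1 then (\<Sum>n. a n * w ^ n) else 0)"

definition H2 :: "(complex \<Rightarrow> complex) set" where
  "H2 = {disk_series a |a. summable (\<lambda>n. (cmod (a n))\<^sup>2)}"

definition taylor_coeff :: "(complex \<Rightarrow> complex) \<Rightarrow> nat \<Rightarrow> complex" where
  "taylor_coeff f n = (deriv ^^ n) f 0 / fact n"

definition H2_inner :: "(complex \<Rightarrow> complex) \<Rightarrow> (complex \<Rightarrow> complex) \<Rightarrow> complex" where
  "H2_inner f g = (\<Sum>n. taylor_coeff f n * cnj (taylor_coeff g n))"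

definition H2_norm :: "(complex \<Rightarrow> complex) \<Rightarrow> real" where
  "H2_norm f = sqrt (\<Sum>n. (cmod (taylor_coeff f n))\<^sup>2)"

text \<open>For a bounded analytic \<open>b\<close> the product below lies in \<open>H2\<close> automatically.\<close>

definition inner_function :: "(complex \<Rightarrow> complex) \<Rightarrow> bool" where
  "inner_function b \<longleftrightarrow> b holomorphic_on ball 0 1 \<and> bounded (b ` ball 0 1) \<and>
     (\<forall>f\<in>H2. H2_norm (\<lambda>w. b w * f w) = H2_norm f)"

text \<open>The space \<open>C(X, H2)\<close> of functions continuous with respect to the norm of \<open>H2\<close>.\<close>

definition C_X_H2 :: "('x::topological_space \<Rightarrow> complex \<Rightarrow> complex) set" where
  "C_X_H2 = {F. (\<forall>x. F x \<in> H2) \<and>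
     (\<forall>x. ((\<lambda>y. H2_norm (\<lambda>w. F y w - F x w)) \<longlongrightarrow> 0) (at x))}"

definition perp_mult ::
    "('x \<Rightarrow> complex \<Rightarrow> complex) \<Rightarrow> ('x::topological_space \<Rightarrow> complex \<Rightarrow> complex) set" where
  "perp_mult b = {h \<in> C_X_H2. \<forall>x. \<forall>f\<in>C_X_H2. H2_inner (h x) (\<lambda>w. b x w * f x w) = 0}"

definition (in hilbert_CX_module) analysis_operator ::
    "(nat \<Rightarrow> 'h) \<Rightarrow> 'h \<Rightarrow> 'x \<Rightarrow> complex \<Rightarrow> complex" where
  "analysis_operator e f = (\<lambda>x. disk_series (\<lambda>n. inner_CX f (e n) x))"

section \<open>Herglotz measures\<close>

definition borel_prob_unit :: "real measure \<Rightarrow> bool" where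
  "borel_prob_unit M \<longleftrightarrow> prob_space M \<and> sets M = sets (restrict_space borel {0..<1})"

definition herglotz_measure :: "(complex \<Rightarrow> complex) \<Rightarrow> real measure \<Rightarrow> bool" where
  "herglotz_measure b M \<longleftrightarrow> borel_prob_unit M \<and>
     (\<forall>w\<in>ball 0 1. (1 + b w) / (1 - b w) =
        (\<integral>y. (1 + w * cis (- 2 * pi * y)) / (1 - w * cis (- 2 * pi * y)) \<partial>M))"

definition weakly_continuous_family :: "('x::topological_space \<Rightarrow> real measure) \<Rightarrow> bool" where
  "weakly_continuous_family \<mu> \<longleftrightarrow>
     (\<forall>g :: real \<Rightarrow> complex. continuous_on {0..<1} g \<and> bounded (g ` {0..<1}) \<longrightarrow>
        continuous_on UNIV (\<lambda>x. \<integral>y. g y \<partial>\<mu> x))"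

end

theory Submission
  imports Defs "HOL-Complex_Analysis.Laurent_Convergence"
begin

text \<open>
  The operator \<open>T\<close> is the adjoint of the backward shift, transported to \<open>H\<close> by the analysis operator.

  A function \<open>h\<close> orthogonal to every \<open>b f\<close> is in particular orthogonal to every \<open>b (w f) = w (b f)\<close>.
  On the Hardy space, multiplication by \<open>w\<close> shifts Taylor coefficients up, and its adjoint drops the
  constant coefficient and shifts the others down. Hence the orthogonal complement of \<open>b C(X, H2)\<close>
  is mapped into itself by the backward shift (\<open>perp_mult_backward_shift\<close>). As this complement is the
  range of the analysis operator, every \<open>u\<close> in \<open>H\<close> has a partner \<open>V u\<close> with
  \<open>\<langle>V u, e\<^sub>n\<rangle> = \<langle>u, e\<^sub>n\<^sub>+\<^sub>1\<rangle>\<close> for all \<open>n\<close>.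

  An adjoint \<open>T\<close> of \<open>V\<close> has the desired property, since
  \<open>\<langle>T e\<^sub>n, u\<rangle> = \<langle>e\<^sub>n, V u\<rangle> = \<langle>e\<^sub>n\<^sub>+\<^sub>1, u\<rangle>\<close> for all \<open>u\<close>. Bounded operators on Hilbert modules need not have
  adjoints, and here the frame supplies one. The frame operator \<open>S f = \<Sum>n. \<langle>f, e\<^sub>n\<rangle> e\<^sub>n\<close> is onto
  (\<open>frame_operator_surjective\<close>), and on \<open>g = S f\<close> the adjoint is given by the convergent series
  \<open>\<Sum>n. \<langle>f, e\<^sub>n\<rangle> e\<^sub>n\<^sub>+\<^sub>1\<close> (\<open>synthesis\<close>, \<open>shift_operator_exists\<close>). Its linearity and its
  bound \<open>sqrt (B / A)\<close>, for frame bounds \<open>A\<close> and \<open>B\<close>, follow from \<open>\<langle>T g, u\<rangle> = \<langle>g, V u\<rangle>\<close>.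
\<close>

section \<open>Coefficient sequences and shifts on the Hardy space\<close>

definition square_summable :: "(nat \<Rightarrow> complex) \<Rightarrow> bool" where
  "square_summable a \<longleftrightarrow> summable (\<lambda>n. (cmod (a n))\<^sup>2)"

lemma mult_le_sum_squares:
  fixes x y :: real
  shows "x * y \<le> x\<^sup>2 + y\<^sup>2"
proof -
  have "2 * (x * y) \<le> x\<^sup>2 + y\<^sup>2"
    using sum_squares_bound[of x y] by simp
  moreover have "0 \<le> x\<^sup>2 + y\<^sup>2"
    by simp
  ultimately show ?thesis by linarith
qed

lemma square_summable_diff:
  assumes "square_summable a" "square_summable c"
  shows "square_summable (\<lambda>n. a n - c n)"
  unfolding square_summable_def
proof (rule summable_comparison_test')
  show "summable (\<lambda>n. 2 * ((cmod (a n))\<^sup>2 + (cmod (c n))\<^sup>2))"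
    using assms unfolding square_summable_def by (intro summable_mult summable_add)
  fix n
  have "(cmod (a n - c n))\<^sup>2 \<le> (cmod (a n) + cmod (c n))\<^sup>2"
    by (intro power_mono norm_triangle_ineq4) simp
  also have "\<dots> \<le> 2 * ((cmod (a n))\<^sup>2 + (cmod (c n))\<^sup>2)"
    using sum_squares_bound[of "cmod (a n)" "cmod (c n)"] by (simp add: power2_sum)
  finally show "norm ((cmod (a n - c n))\<^sup>2) \<le> 2 * ((cmod (a n))\<^sup>2 + (cmod (c n))\<^sup>2)"
    by simp
qed

lemma square_summable_shift:
  "square_summable (\<lambda>n. a (Suc n)) \<longleftrightarrow> square_summable a"
  unfolding square_summable_def by (rule summable_Suc_iff)

lemma sums_disk_series:
  assumes "square_summable a" "w \<in> ball 0 1"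
  shows "(\<lambda>n. a n * w ^ n) sums disk_series a w"
proof -
  have w: "(cmod w)\<^sup>2 < 1"
    using assms(2) by (simp add: abs_square_less_1)
  have "summable (\<lambda>n. a n * w ^ n)"
  proof (rule summable_comparison_test')
    show "summable (\<lambda>n. (cmod (a n))\<^sup>2 + ((cmod w)\<^sup>2) ^ n)"
      using assms(1) w unfolding square_summable_def
      by (intro summable_add summable_geometric) simp_all
    show "norm (a n * w ^ n) \<le> (cmod (a n))\<^sup>2 + ((cmod w)\<^sup>2) ^ n" for n
      using mult_le_sum_squares[of "cmod (a n)" "cmod w ^ n"]
      by (simp add: norm_mult norm_power power_mult[symmetric] mult.commute)
  qed
  then show ?thesis
    using assms(2) by (simp add: disk_series_def summable_sums)
qed

lemma has_fps_expansion_disk_series: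
  assumes "square_summable a"
  shows "disk_series a has_fps_expansion Abs_fps a"
proof (rule has_fps_expansionI)
  have "eventually (\<lambda>w::complex. w \<in> ball 0 1) (nhds 0)"
    by (intro eventually_nhds_in_open) auto
  then show "eventually (\<lambda>w. (\<lambda>n. fps_nth (Abs_fps a) n * w ^ n) sums disk_series a w) (nhds 0)"
    by eventually_elim (simp add: sums_disk_series assms)
qed

lemma taylor_coeff_fps:
  assumes "f has_fps_expansion F"
  shows "taylor_coeff f n = fps_nth F n"
  unfolding taylor_coeff_def fps_nth_fps_expansion[OF assms] ..

lemma taylor_coeff_disk_series:
  assumes "square_summable a"
  shows "taylor_coeff (disk_series a) = a"
  by (rule ext) (simp add: taylor_coeff_fps[OF has_fps_expansion_disk_series[OF assms]])

lemma disk_series_inject: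
  assumes "square_summable a" "square_summable c" "disk_series a = disk_series c"
  shows "a = c"
  by (metis assms taylor_coeff_disk_series)

lemma H2_iff: "f \<in> H2 \<longleftrightarrow> (\<exists>a. square_summable a \<and> f = disk_series a)"
  unfolding H2_def square_summable_def by auto

lemma disk_series_diff:
  assumes "square_summable a" "square_summable c"
  shows "(\<lambda>w. disk_series a w - disk_series c w) = disk_series (\<lambda>n. a n - c n)"
proof
  fix w
  show "disk_series a w - disk_series c w = disk_series (\<lambda>n. a n - c n) w"
  proof (cases "w \<in> ball 0 1")
    case True
    have "(\<lambda>n. (a n - c n) * w ^ n) sums (disk_series a w - disk_series c w)"
      using sums_diff[OF sums_disk_series[OF assms(1) True] sums_disk_series[OF assms(2) True]]
      by (simp add: algebra_simps)
    with sums_disk_series[OF square_summable_diff[OF assms] True] show ?thesis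
      by (rule sums_unique2[symmetric])
  qed (simp add: disk_series_def)
qed

lemma H2_norm_disk_series:
  assumes "square_summable a"
  shows "H2_norm (disk_series a) = sqrt (\<Sum>n. (cmod (a n))\<^sup>2)"
  unfolding H2_norm_def taylor_coeff_disk_series[OF assms] ..

lemma holomorphic_disk_series:
  assumes "square_summable a"
  shows "disk_series a holomorphic_on ball 0 1"
proof (rule power_series_holomorphic)
  show "(\<lambda>n. a n * (w - 0) ^ n) sums disk_series a w" if "w \<in> ball 0 1" for w
    using sums_disk_series[OF assms that] by simp
qed

lemma taylor_coeff_times_z:
  assumes "g holomorphic_on ball 0 1"
  shows "taylor_coeff (\<lambda>w. w * g w) 0 = 0"
    and "taylor_coeff (\<lambda>w. w * g w) (Suc n) = taylor_coeff g n"
proof -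
  have "g analytic_on {0}"
    using assms by (auto simp: analytic_at intro!: exI[of _ "ball 0 1"])
  then have g: "g has_fps_expansion fps_expansion g 0"
    by (rule analytic_at_imp_has_fps_expansion_0)
  have zg: "(\<lambda>w. w * g w) has_fps_expansion fps_X * fps_expansion g 0"
    by (intro has_fps_expansion_mult has_fps_expansion_fps_X g)
  show "taylor_coeff (\<lambda>w. w * g w) 0 = 0"
    and "taylor_coeff (\<lambda>w. w * g w) (Suc n) = taylor_coeff g n"
    unfolding taylor_coeff_fps[OF zg] taylor_coeff_fps[OF g] by simp_all
qed

text \<open>
  The backward shift is the adjoint of multiplication by the variable: the constant Taylor
  coefficient of \<open>w g(w)\<close> vanishes and the others are those of \<open>g\<close>, moved up by one. It is used for
  products \<open>g = b f\<close>.
\<close>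

lemma H2_inner_times_z:
  assumes "square_summable a" "g holomorphic_on ball 0 1"
  shows "H2_inner (disk_series (\<lambda>n. a (Suc n))) g = H2_inner (disk_series a) (\<lambda>w. w * g w)"
proof -
  (* suminf is the value picked out by sums, so the equivalence sums_Suc_iff suffices *)
  have eq: "suminf f = (\<Sum>n. f (Suc n))" if "f 0 = 0" for f :: "nat \<Rightarrow> complex"
    using sums_Suc_iff[of f] that by (simp add: suminf_def)
  have "square_summable (\<lambda>n. a (Suc n))"
    using assms(1) by (simp add: square_summable_shift)
  then show ?thesis
    unfolding H2_inner_def using assms
    by (subst eq[of "\<lambda>n. taylor_coeff (disk_series a) n * cnj (taylor_coeff (\<lambda>w. w * g w) n)"])
      (simp_all add: taylor_coeff_times_z taylor_coeff_disk_series)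
qed

lemma times_z_disk_series:
  assumes "square_summable a"
  shows "(\<lambda>w. w * disk_series a w) = disk_series (case_nat 0 a)"
proof
  fix w
  have a: "square_summable (case_nat 0 a)"
    using assms square_summable_shift[of "case_nat 0 a"] by simp
  show "w * disk_series a w = disk_series (case_nat 0 a) w"
  proof (cases "w \<in> ball 0 1")
    case True
    have "(\<lambda>n. case_nat 0 a (Suc n) * w ^ Suc n) sums (w * disk_series a w)"
      using sums_mult[OF sums_disk_series[OF assms True], of w] by (simp add: algebra_simps)
    then have "(\<lambda>n. case_nat 0 a n * w ^ n) sums (w * disk_series a w)"
      by (subst (asm) sums_Suc_iff) simp
    with sums_disk_series[OF a True] show ?thesis
      by (rule sums_unique2[symmetric])
  qed (simp add: disk_series_def)
qed

text \<open>
  Coefficientwise description of \<open>C(X, H2)\<close>: a continuous function into the Hardy space is a family of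
  square-summable sequences that is continuous in the \<open>\<ell>\<^sup>2\<close> distance. Both shifts are
  read off from it, because they do not increase this distance.
\<close>

lemma C_X_H2_iff:
  "F \<in> C_X_H2 \<longleftrightarrow> (\<exists>a. (\<forall>x. square_summable (a x)) \<and> F = (\<lambda>x. disk_series (a x)) \<and>
     (\<forall>x. ((\<lambda>y. \<Sum>n. (cmod (a y n - a x n))\<^sup>2) \<longlongrightarrow> 0) (at x)))" (is "_ \<longleftrightarrow> ?rhs")
proof -
  have lim: "((\<lambda>y. H2_norm (\<lambda>w. disk_series (a y) w - disk_series (a x) w)) \<longlongrightarrow> 0) (at x) \<longleftrightarrow>
      ((\<lambda>y. \<Sum>n. (cmod (a y n - a x n))\<^sup>2) \<longlongrightarrow> 0) (at x)"
    if a: "\<And>x. square_summable (a x)" for a and x :: 'a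
  proof -
    have N: "H2_norm (\<lambda>w. disk_series (a y) w - disk_series (a x) w)
        = sqrt (\<Sum>n. (cmod (a y n - a x n))\<^sup>2)" for y
      by (simp add: disk_series_diff a H2_norm_disk_series square_summable_diff)
    have nn: "0 \<le> (\<Sum>n. (cmod (a y n - a x n))\<^sup>2)" for y
      using square_summable_diff[OF a a, of y x] unfolding square_summable_def
      by (intro suminf_nonneg) auto
    show ?thesis
      unfolding N
    proof
      assume "((\<lambda>y. sqrt (\<Sum>n. (cmod (a y n - a x n))\<^sup>2)) \<longlongrightarrow> 0) (at x)"
      from tendsto_power[OF this, of 2]
      show "((\<lambda>y. \<Sum>n. (cmod (a y n - a x n))\<^sup>2) \<longlongrightarrow> 0) (at x)"
        by (simp add: nn)
    next
      assume "((\<lambda>y. \<Sum>n. (cmod (a y n - a x n))\<^sup>2) \<longlongrightarrow> 0) (at x)"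
      from tendsto_real_sqrt[OF this]
      show "((\<lambda>y. sqrt (\<Sum>n. (cmod (a y n - a x n))\<^sup>2)) \<longlongrightarrow> 0) (at x)"
        by simp
    qed
  qed
  show ?thesis
  proof
    assume F: "F \<in> C_X_H2"
    then have "\<forall>x. \<exists>a. square_summable a \<and> F x = disk_series a"
      by (auto simp: C_X_H2_def H2_iff)
    then obtain a where a: "\<And>x. square_summable (a x)" "\<And>x. F x = disk_series (a x)"
      by metis
    with F lim[of a] show ?rhs
      by (intro exI[of _ a]) (auto simp: C_X_H2_def)
  next
    assume ?rhs
    then obtain a where a: "\<And>x. square_summable (a x)" "F = (\<lambda>x. disk_series (a x))"
      "\<And>x. ((\<lambda>y. \<Sum>n. (cmod (a y n - a x n))\<^sup>2) \<longlongrightarrow> 0) (at x)"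
      by blast
    with lim[of a] show "F \<in> C_X_H2"
      by (auto simp: C_X_H2_def H2_iff)
  qed
qed

lemma C_X_H2_times_z:
  assumes "F \<in> C_X_H2"
  shows "(\<lambda>x w. w * F x w) \<in> C_X_H2"
proof -
  obtain a where a: "\<And>x. square_summable (a x)" "F = (\<lambda>x. disk_series (a x))"
      "\<And>x. ((\<lambda>y. \<Sum>n. (cmod (a y n - a x n))\<^sup>2) \<longlongrightarrow> 0) (at x)"
    using assms by (auto simp: C_X_H2_iff)
  let ?s = "\<lambda>x. case_nat 0 (a x)"
  have s: "square_summable (?s x)" for x
    using a(1) square_summable_shift[of "?s x"] by simp
  have "(\<Sum>n. (cmod (?s y n - ?s x n))\<^sup>2) = (\<Sum>n. (cmod (a y n - a x n))\<^sup>2)" for x y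
    using suminf_split_head[of "\<lambda>n. (cmod (?s y n - ?s x n))\<^sup>2"] square_summable_diff[OF s s, of y x]
    by (simp add: square_summable_def)
  then show ?thesis
    unfolding C_X_H2_iff using a s by (intro exI[of _ ?s]) (simp add: times_z_disk_series)
qed

lemma C_X_H2_backward_shift:
  assumes a: "\<And>x. square_summable (a x)" and F: "(\<lambda>x. disk_series (a x)) \<in> C_X_H2"
  shows "(\<lambda>x. disk_series (\<lambda>n. a x (Suc n))) \<in> C_X_H2"
proof -
  obtain a' where a': "\<And>x. square_summable (a' x)" "(\<lambda>x. disk_series (a x)) = (\<lambda>x. disk_series (a' x))"
      "\<And>x. ((\<lambda>y. \<Sum>n. (cmod (a' y n - a' x n))\<^sup>2) \<longlongrightarrow> 0) (at x)"
    using F by (auto simp: C_X_H2_iff)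
  have "a' = a"
    using disk_series_inject[OF a a'(1)] fun_cong[OF a'(2)] by fastforce
  with a' have lim: "((\<lambda>y. \<Sum>n. (cmod (a y n - a x n))\<^sup>2) \<longlongrightarrow> 0) (at x)" for x
    by simp
  have sm: "summable (\<lambda>n. (cmod (a y n - a x n))\<^sup>2)" for x y
    using square_summable_diff[OF a a] by (simp add: square_summable_def)
  have "((\<lambda>y. \<Sum>n. (cmod (a y (Suc n) - a x (Suc n)))\<^sup>2) \<longlongrightarrow> 0) (at x)" for x
  proof (rule tendsto_sandwich[OF _ _ tendsto_const lim])
    show "\<forall>\<^sub>F y in at x. 0 \<le> (\<Sum>n. (cmod (a y (Suc n) - a x (Suc n)))\<^sup>2)"
      using sm summable_Suc_iff[of "\<lambda>n. (cmod (a y n - a x n))\<^sup>2" for y]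
      by (intro always_eventually allI suminf_nonneg) simp_all
    show "\<forall>\<^sub>F y in at x. (\<Sum>n. (cmod (a y (Suc n) - a x (Suc n)))\<^sup>2)
        \<le> (\<Sum>n. (cmod (a y n - a x n))\<^sup>2)"
      using suminf_split_head[OF sm] by (intro always_eventually allI) simp
  qed
  then show ?thesis
    unfolding C_X_H2_iff using a
    by (intro exI[of _ "\<lambda>x n. a x (Suc n)"]) (simp add: square_summable_shift)
qed

text \<open>
  The product of \<open>w\<close> with a test function \<open>f\<close> is again a test function, and \<open>b (w f) = w (b f)\<close>. Hence a
  function orthogonal to all \<open>b f\<close> is orthogonal to all \<open>w (b f)\<close>, which by the adjoint relation says
  that its backward shift is orthogonal to all \<open>b f\<close>.
\<close>

lemma perp_mult_backward_shift:
  assumes a: "\<And>x. square_summable (a x)" and h: "(\<lambda>x. disk_series (a x)) \<in> perp_mult b"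
    and b: "\<And>x. b x holomorphic_on ball 0 1"
  shows "(\<lambda>x. disk_series (\<lambda>n. a x (Suc n))) \<in> perp_mult b"
proof -
  have "H2_inner (disk_series (\<lambda>n. a x (Suc n))) (\<lambda>w. b x w * f x w) = 0" if f: "f \<in> C_X_H2" for x f
  proof -
    have "f x holomorphic_on ball 0 1"
      using f holomorphic_disk_series unfolding C_X_H2_iff by metis
    then have bf: "(\<lambda>w. b x w * f x w) holomorphic_on ball 0 1"
      by (intro holomorphic_on_mult b)
    have "\<forall>f\<in>C_X_H2. H2_inner (disk_series (a x)) (\<lambda>w. b x w * f x w) = 0"
      using h by (simp add: perp_mult_def)
    from bspec[OF this C_X_H2_times_z[OF f]]
    have "H2_inner (disk_series (a x)) (\<lambda>w. b x w * (w * f x w)) = 0"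
      by simp
    then show ?thesis
      by (simp add: H2_inner_times_z[OF a bf] ac_simps)
  qed
  moreover have "(\<lambda>x. disk_series (a x)) \<in> C_X_H2"
    using h unfolding perp_mult_def by blast
  then have "(\<lambda>x. disk_series (\<lambda>n. a x (Suc n))) \<in> C_X_H2"
    by (rule C_X_H2_backward_shift[OF a])
  ultimately show ?thesis
    by (simp add: perp_mult_def)
qed

section \<open>Pointwise estimates in Hilbert modules\<close>

text \<open>
  The form in which norm convergence of the frame series in \<open>C(X)\<close> is used: its small blocks make the
  blocks of the corresponding series in \<open>H\<close> small.
\<close>

lemma summable_imp_small_blocks:
  fixes f :: "nat \<Rightarrow> 'a::real_normed_vector"
  assumes "summable f" "0 < r"
  shows "\<exists>N. \<forall>m\<ge>N. \<forall>n. norm (sum f {m..<n}) < r"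
proof -
  have "Cauchy (\<lambda>n. sum f {..<n})"
    using assms(1) unfolding summable_iff_convergent by (rule convergent_Cauchy)
  from CauchyD[OF this assms(2)] obtain N where
    N: "\<forall>m\<ge>N. \<forall>n\<ge>N. norm (sum f {..<m} - sum f {..<n}) < r"
    by blast
  have "norm (sum f {m..<n}) < r" if "N \<le> m" for m n
  proof (cases "m \<le> n")
    case True
    have "sum f {m..<n} = sum f {..<n} - sum f {..<m}"
      using sum_diff_nat_ivl[of 0 m n f] True by (simp add: atLeast0LessThan)
    then show ?thesis
      using N that True by simp
  qed (use assms(2) in simp)
  then show ?thesis by blast
qed

context hilbert_CX_module
begin

lemma inner_scaleC_left: "inner_CX (scaleC c u) v x = c * inner_CX u v x"
  by (simp add: scaleC_eq_act inner_act_left times_bcontfun.rep_eq)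

lemma inner_scaleR_left: "inner_CX (r *\<^sub>R u) v x = complex_of_real r * inner_CX u v x"
  by (simp add: scaleR_eq_scaleC inner_scaleC_left)

lemma inner_diff_left: "inner_CX (u - v) w x = inner_CX u w x - inner_CX v w x"
  using arg_cong[OF inner_add_left[of "u - v" v w], of "\<lambda>f. apply_bcontfun f x"] by simp

lemma inner_sum_left: "inner_CX (sum f I) w x = (\<Sum>i\<in>I. inner_CX (f i) w x)"
proof -
  have "inner_CX 0 w x = 0"
    using inner_diff_left[of 0 0 w x] by simp
  then show ?thesis
    by (induction I rule: infinite_finite_induct) (simp_all add: inner_add_left)
qed

lemma inner_diff_right: "inner_CX w (u - v) x = inner_CX w u x - inner_CX w v x"
  using inner_commute[of w "u - v" x] inner_commute[of w u x] inner_commute[of w v x]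
  by (simp add: inner_diff_left)

lemma inner_scaleR_right: "inner_CX v (r *\<^sub>R u) x = complex_of_real r * inner_CX v u x"
  using inner_commute[of v "r *\<^sub>R u" x] inner_commute[of v u x]
  by (simp add: inner_scaleR_left)

lemma inner_scaleC_right: "inner_CX v (scaleC c u) x = cnj c * inner_CX v u x"
  using inner_commute[of v "scaleC c u" x] inner_commute[of v u x]
  by (simp add: inner_scaleC_left)

text \<open>
  Operators are described below by their inner products with arbitrary vectors at arbitrary points;
  additivity, homogeneity and values on the frame then follow from definiteness.
\<close>

lemma eq_by_inner:
  assumes "\<And>w x. inner_CX u w x = inner_CX v w x"
  shows "u = v"
proof -
  have "inner_CX (u - v) (u - v) = 0"
    by (rule bcontfun_eqI) (simp add: inner_diff_left assms)
  then show ?thesis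
    using inner_definite by fastforce
qed

text \<open>
  Estimates are made pointwise on \<open>X\<close>, where they are inequalities between real numbers;
  \<open>sq_norm_le_norm\<close> and \<open>norm_le_of_sq_norm_le\<close> transfer them to \<open>H\<close>.
\<close>

definition sq_norm :: "'h \<Rightarrow> 'x \<Rightarrow> real" where
  "sq_norm u x = Re (inner_CX u u x)"

lemma inner_self: "inner_CX u u x = complex_of_real (sq_norm u x)"
  using inner_nonneg[of u x] by (simp add: sq_norm_def less_eq_complex_def complex_eq_iff)

lemma sq_norm_nonneg: "0 \<le> sq_norm u x"
  using inner_nonneg[of u x] by (simp add: sq_norm_def less_eq_complex_def)

lemma norm_power2: "(norm u)\<^sup>2 = norm (inner_CX u u)"
  by (simp add: norm_eq)

lemma sq_norm_le_norm: "sq_norm u x \<le> (norm u)\<^sup>2"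
  using norm_bounded[of "inner_CX u u" x] sq_norm_nonneg[of u x]
  by (simp add: norm_power2 inner_self)

lemma norm_le_of_sq_norm_le:
  assumes "\<And>x. sq_norm u x \<le> C"
  shows "(norm u)\<^sup>2 \<le> C"
  unfolding norm_power2
  by (rule norm_bound) (simp add: inner_self sq_norm_nonneg assms)

lemma sq_norm_diff_scaleR:
  "sq_norm (u - r *\<^sub>R v) x = sq_norm u x - 2 * r * Re (inner_CX v u x) + r\<^sup>2 * sq_norm v x"
  using inner_commute[of u v x]
  by (simp add: sq_norm_def inner_diff_left inner_diff_right inner_scaleR_left inner_scaleR_right
      power2_eq_square algebra_simps)

text \<open>
  At a fixed point \<open>x\<close> the inner product is only a semidefinite form, so \<open>sq_norm v x\<close> may vanish for
  nonzero \<open>v\<close>. The quadratic polynomial below in the real parameter \<open>s\<close> is nonnegative; in the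
  degenerate case it is affine and its slope has to be zero.
\<close>

lemma inner_Cauchy_Schwarz: "(cmod (inner_CX u v x))\<^sup>2 \<le> sq_norm u x * sq_norm v x"
proof -
  define z where "z = inner_CX u v x"
  define q where "q = sq_norm v x"
  have zz: "z * cnj z = complex_of_real ((cmod z)\<^sup>2)"
    by (rule complex_norm_square[symmetric])
  have pos: "0 \<le> sq_norm u x - 2 * s * (cmod z)\<^sup>2 + s\<^sup>2 * ((cmod z)\<^sup>2 * q)" for s
  proof -
    have "inner_CX v u x = cnj z"
      unfolding z_def by (rule inner_commute)
    then have "Re (inner_CX (scaleC z v) u x) = (cmod z)\<^sup>2"
      unfolding inner_scaleC_left by (metis Re_complex_of_real zz)
    moreover have "sq_norm (scaleC z v) x = (cmod z)\<^sup>2 * q"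
    proof -
      have "inner_CX (scaleC z v) (scaleC z v) x = (z * cnj z) * complex_of_real q"
        unfolding inner_scaleC_left inner_scaleC_right q_def by (simp add: inner_self)
      then show ?thesis
        unfolding zz sq_norm_def by (simp only: of_real_mult[symmetric] Re_complex_of_real)
    qed
    ultimately show ?thesis
      using sq_norm_nonneg[of "u - s *\<^sub>R scaleC z v" x] by (simp add: sq_norm_diff_scaleR)
  qed
  have q: "0 \<le> q"
    unfolding q_def by (rule sq_norm_nonneg)
  show ?thesis
  proof (cases "q = 0")
    case True
    have "(cmod z)\<^sup>2 = 0"
    proof (rule ccontr)
      assume "(cmod z)\<^sup>2 \<noteq> 0"
      (* any s beyond the zero of the affine function s \<mapsto> sq_norm u x - 2 s |z|^2 *)
      with pos[of "(sq_norm u x + 1) / (2 * (cmod z)\<^sup>2)"] True show False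
        by simp
    qed
    then show ?thesis
      using sq_norm_nonneg by (simp add: z_def)
  next
    case False
    with q have "0 < q" by simp
    with pos[of "1 / q"] show ?thesis
      by (simp add: z_def[symmetric] q_def[symmetric] power2_eq_square field_simps)
  qed
qed

lemma bounded_linear_inner: "bounded_linear (\<lambda>u. inner_CX u v x)"
proof (rule bounded_linear_intro)
  show "norm (inner_CX u v x) \<le> norm u * norm v" for u
  proof (rule power2_le_imp_le)
    have "sq_norm u x * sq_norm v x \<le> (norm u)\<^sup>2 * (norm v)\<^sup>2"
      by (intro mult_mono sq_norm_le_norm sq_norm_nonneg) simp
    with inner_Cauchy_Schwarz[of u v x] show "(norm (inner_CX u v x))\<^sup>2 \<le> (norm u * norm v)\<^sup>2"
      by (simp add: power_mult_distrib)
  qed simp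
qed (simp_all add: inner_add_left inner_scaleR_left scaleR_conv_of_real)

end

section \<open>Standard frames and the frame operator\<close>

locale CX_frame = hilbert_CX_module scaleC act inner_CX
  for scaleC :: "complex \<Rightarrow> 'h::banach \<Rightarrow> 'h"
    and act :: "('x::topological_space \<Rightarrow>\<^sub>C complex) \<Rightarrow> 'h \<Rightarrow> 'h"
    and inner_CX :: "'h \<Rightarrow> 'h \<Rightarrow> ('x \<Rightarrow>\<^sub>C complex)" +
  fixes e :: "nat \<Rightarrow> 'h" and A B :: real
  assumes A_pos: "0 < A" and B_pos: "0 < B"
    and frame: "\<And>f. \<exists>S. (\<lambda>n. inner_CX f (e n) * inner_CX (e n) f) sums S \<and>
     (\<forall>x. complex_of_real A * inner_CX f f x \<le> S x \<and>
          S x \<le> complex_of_real B * inner_CX f f x)"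
begin

definition frame_sum :: "'h \<Rightarrow> 'x \<Rightarrow> real" where
  "frame_sum f x = (\<Sum>n. (cmod (inner_CX f (e n) x))\<^sup>2)"

lemma frame_term: "(inner_CX f (e n) * inner_CX (e n) f) x = complex_of_real ((cmod (inner_CX f (e n) x))\<^sup>2)"
  using inner_commute[of "e n" f x]
  by (simp add: times_bcontfun.rep_eq complex_norm_square[symmetric])

lemma summable_frame: "summable (\<lambda>n. inner_CX f (e n) * inner_CX (e n) f)"
  using frame[of f] sums_summable by blast

lemma
  shows frame_sums: "(\<lambda>n. (cmod (inner_CX f (e n) x))\<^sup>2) sums frame_sum f x"
    and lower_frame_bound: "A * sq_norm f x \<le> frame_sum f x"
    and upper_frame_bound: "frame_sum f x \<le> B * sq_norm f x"
proof -
  obtain S where S: "(\<lambda>n. inner_CX f (e n) * inner_CX (e n) f) sums S"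
    "complex_of_real A * inner_CX f f x \<le> S x" "S x \<le> complex_of_real B * inner_CX f f x"
    using frame[of f] by blast
  have eval: "bounded_linear (\<lambda>g :: 'x \<Rightarrow>\<^sub>C complex. g x)"
    by (rule bounded_linear_intro[where K = 1]) (simp_all add: norm_bounded)
  have "(\<lambda>n. complex_of_real ((cmod (inner_CX f (e n) x))\<^sup>2)) sums S x"
    using bounded_linear.sums[OF eval S(1)] unfolding frame_term .
  then have "(\<lambda>n. (cmod (inner_CX f (e n) x))\<^sup>2) sums Re (S x)"
    using sums_Re by fastforce
  moreover from this have "Re (S x) = frame_sum f x"
    unfolding frame_sum_def by (rule sums_unique)
  ultimately show "(\<lambda>n. (cmod (inner_CX f (e n) x))\<^sup>2) sums frame_sum f x"
    "A * sq_norm f x \<le> frame_sum f x" "frame_sum f x \<le> B * sq_norm f x"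
    using S(2,3) by (simp_all add: inner_self less_eq_complex_def)
qed

text \<open>
  The synthesis map has the same bound as the analysis map: with \<open>t\<close> the finite combination,
  \<open>\<langle>t, t\<rangle>\<close> is paired with the coefficients \<open>\<langle>e\<^sub>i, t\<rangle>\<close>, whose square sum is at most
  \<open>B \<langle>t, t\<rangle>\<close> by the upper frame bound, and one factor \<open>\<langle>t, t\<rangle>\<close> cancels. The offset \<open>k\<close> is harmless
  since it only selects a part of the frame.
\<close>

lemma sq_norm_synthesis_le:
  assumes I: "finite I"
  shows "sq_norm (\<Sum>i\<in>I. act (c i) (e (i + k))) x \<le> B * (\<Sum>i\<in>I. (cmod (c i x))\<^sup>2)"
proof -
  define t where "t = (\<Sum>i\<in>I. act (c i) (e (i + k)))"
  define q where "q = sq_norm t x"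
  define C where "C = (\<Sum>i\<in>I. (cmod (c i x))\<^sup>2)"
  define D where "D = (\<Sum>i\<in>I. (cmod (inner_CX (e (i + k)) t x))\<^sup>2)"
  have C: "0 \<le> C" and D: "0 \<le> D" and q: "0 \<le> q"
    unfolding C_def D_def q_def by (simp_all add: sum_nonneg sq_norm_nonneg)
  have "q = cmod (inner_CX t t x)"
    using q by (simp add: inner_self q_def)
  also have "inner_CX t t x = (\<Sum>i\<in>I. c i x * inner_CX (e (i + k)) t x)"
    by (subst (1) t_def) (simp add: inner_sum_left inner_act_left times_bcontfun.rep_eq)
  also have "cmod \<dots> \<le> (\<Sum>i\<in>I. \<bar>cmod (c i x)\<bar> * \<bar>cmod (inner_CX (e (i + k)) t x)\<bar>)"
    by (rule order_trans[OF norm_sum]) (simp add: norm_mult)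
  also have "\<dots> \<le> sqrt C * sqrt D"
    unfolding C_def D_def L2_set_def[symmetric] by (rule L2_set_mult_ineq)
  finally have "q\<^sup>2 \<le> (sqrt C * sqrt D)\<^sup>2"
    using q by (rule power_mono)
  then have "q\<^sup>2 \<le> C * D"
    using C D by (simp add: power_mult_distrib)
  have DB: "D \<le> B * q"
  proof -
    have "D = (\<Sum>i\<in>I. (cmod (inner_CX t (e (i + k)) x))\<^sup>2)"
      unfolding D_def by (subst inner_commute) simp
    also have "\<dots> = (\<Sum>n\<in>(\<lambda>i. i + k) ` I. (cmod (inner_CX t (e n) x))\<^sup>2)"
      by (simp add: sum.reindex)
    also have "\<dots> \<le> frame_sum t x"
      unfolding frame_sum_def using I sums_summable[OF frame_sums] by (intro sum_le_suminf) auto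
    also have "\<dots> \<le> B * q"
      unfolding q_def by (rule upper_frame_bound)
    finally show ?thesis .
  qed
  then have "C * D \<le> C * (B * q)"
    using C by (rule mult_left_mono)
  with \<open>q\<^sup>2 \<le> C * D\<close> have "q * q \<le> (B * C) * q"
    by (simp add: power2_eq_square mult_ac)
  then have "q \<le> B * C"
    using q C B_pos by (cases "q = 0") (auto simp: mult_le_cancel_right)
  then show ?thesis
    unfolding q_def t_def C_def .
qed

text \<open>
  The series \<open>\<Sum>n. \<langle>f, e\<^sub>n\<rangle> e\<^sub>n\<^sub>+\<^sub>k\<close> converges in \<open>H\<close>: its blocks are controlled by the blocks of the
  frame series of \<open>f\<close>, which converges in the norm of \<open>C(X)\<close>. For \<open>k = 0\<close> the limit is the frame operator
  applied to \<open>f\<close>, for \<open>k = 1\<close> it is the shifted operator from which \<open>T\<close> is built.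
\<close>

lemma synthesis:
  "\<exists>t. (\<forall>u x. (\<lambda>n. inner_CX f (e n) x * inner_CX (e (n + k)) u x) sums inner_CX t u x) \<and>
     (\<forall>x. sq_norm t x \<le> B * frame_sum f x)"
proof -
  define g where "g n = act (inner_CX f (e n)) (e (n + k))" for n
  have le: "(norm (sum g {m..<n}))\<^sup>2 \<le> B * norm (\<Sum>i=m..<n. inner_CX f (e i) * inner_CX (e i) f)"
    for m n
  proof (rule norm_le_of_sq_norm_le)
    fix x
    have eval_sum: "apply_bcontfun (sum h I) x = (\<Sum>i\<in>I. h i x)" for h :: "nat \<Rightarrow> 'x \<Rightarrow>\<^sub>C complex" and I
      by (induction I rule: infinite_finite_induct) simp_all
    let ?F = "\<Sum>i=m..<n. inner_CX f (e i) * inner_CX (e i) f"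
    have F: "?F x = complex_of_real (\<Sum>i=m..<n. (cmod (inner_CX f (e i) x))\<^sup>2)"
      unfolding eval_sum frame_term by simp
    have "(\<Sum>i=m..<n. (cmod (inner_CX f (e i) x))\<^sup>2) \<le> norm ?F"
      using norm_bounded[of ?F x] unfolding F norm_of_real by linarith
    with sq_norm_synthesis_le[of "{m..<n}" "\<lambda>i. inner_CX f (e i)" k x] B_pos
    show "sq_norm (sum g {m..<n}) x \<le> B * norm ?F"
      unfolding g_def by (smt (verit) finite_atLeastLessThan mult_left_mono)
  qed
  have "summable g"
    unfolding summable_Cauchy
  proof (intro allI impI)
    fix r :: real assume r: "0 < r"
    then have "0 < r\<^sup>2 / B"
      using B_pos by simp
    then obtain N where
      N: "\<forall>m\<ge>N. \<forall>n. norm (\<Sum>i=m..<n. inner_CX f (e i) * inner_CX (e i) f) < r\<^sup>2 / B"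
      using summable_imp_small_blocks[OF summable_frame] by blast
    have "norm (sum g {m..<n}) < r" if "N \<le> m" for m n
    proof (rule power_less_imp_less_base)
      show "(norm (sum g {m..<n}))\<^sup>2 < r\<^sup>2"
        using le[of m n] N[rule_format, OF that, of n] B_pos
        by (simp add: less_divide_eq mult.commute)
    qed (use r in simp)
    then show "\<exists>N. \<forall>m\<ge>N. \<forall>n. norm (sum g {m..<n}) < r"
      by blast
  qed
  then have t: "g sums suminf g"
    by (rule summable_sums)
  have inner: "(\<lambda>n. inner_CX f (e n) x * inner_CX (e (n + k)) u x) sums inner_CX (suminf g) u x" for u x
    using bounded_linear.sums[OF bounded_linear_inner t, of u x]
    by (simp add: g_def inner_act_left times_bcontfun.rep_eq)
  moreover have "sq_norm (suminf g) x \<le> B * frame_sum f x" for x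
  proof -
    let ?t = "suminf g" and ?P = "\<lambda>N. sum g {..<N}"
    have "(\<lambda>N. inner_CX (?P N) ?t x) \<longlonglongrightarrow> inner_CX ?t ?t x"
      using t unfolding sums_def by (rule bounded_linear.tendsto[OF bounded_linear_inner])
    then have "(\<lambda>N. (cmod (inner_CX (?P N) ?t x))\<^sup>2) \<longlonglongrightarrow> (cmod (inner_CX ?t ?t x))\<^sup>2"
      by (intro tendsto_power tendsto_norm)
    moreover have "(cmod (inner_CX (?P N) ?t x))\<^sup>2 \<le> (B * frame_sum f x) * sq_norm ?t x" for N
    proof -
      have "sq_norm (?P N) x \<le> B * (\<Sum>i<N. (cmod (inner_CX f (e i) x))\<^sup>2)"
        unfolding g_def by (rule sq_norm_synthesis_le) simp
      also have "\<dots> \<le> B * frame_sum f x"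
        unfolding frame_sum_def using B_pos sums_summable[OF frame_sums]
        by (intro mult_left_mono sum_le_suminf) auto
      finally have "sq_norm (?P N) x * sq_norm ?t x \<le> (B * frame_sum f x) * sq_norm ?t x"
        by (intro mult_right_mono sq_norm_nonneg)
      with inner_Cauchy_Schwarz show ?thesis
        by (rule order_trans)
    qed
    ultimately have "(cmod (inner_CX ?t ?t x))\<^sup>2 \<le> (B * frame_sum f x) * sq_norm ?t x"
      by (intro LIMSEQ_le_const2) auto
    then have "sq_norm ?t x * sq_norm ?t x \<le> (B * frame_sum f x) * sq_norm ?t x"
      by (simp add: inner_self power2_eq_square)
    moreover have "0 \<le> B * frame_sum f x"
      using lower_frame_bound[of f x] sq_norm_nonneg[of f x] A_pos B_pos
      by (smt (verit) mult_nonneg_nonneg)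
    ultimately show ?thesis
      using sq_norm_nonneg[of ?t x] by (cases "sq_norm ?t x = 0") (auto simp: mult_le_cancel_right)
  qed
  ultimately show ?thesis
    by blast
qed

text \<open>
  With \<open>S\<close> the frame operator, \<open>d - S d / B\<close> has square norm
  \<open>\<langle>d, d\<rangle> - 2 \<langle>S d, d\<rangle> / B + \<langle>S d, S d\<rangle> / B\<^sup>2\<close>. Since \<open>\<langle>S d, S d\<rangle> \<le> B \<langle>S d, d\<rangle>\<close> and
  \<open>A \<langle>d, d\<rangle> \<le> \<langle>S d, d\<rangle>\<close>, this is at most \<open>(1 - A / B) \<langle>d, d\<rangle>\<close>. So \<open>f \<mapsto> f - S f / B + g / B\<close> is a
  contraction, and its fixed point solves \<open>S f = g\<close>.
\<close>

lemma frame_operator_surjective: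
  "\<exists>f. \<forall>u x. (\<lambda>n. inner_CX f (e n) x * inner_CX (e n) u x) sums inner_CX g u x"
proof -
  have "\<forall>f. \<exists>t. (\<forall>u x. (\<lambda>n. inner_CX f (e n) x * inner_CX (e n) u x) sums inner_CX t u x) \<and>
      (\<forall>x. sq_norm t x \<le> B * frame_sum f x)"
    using synthesis[of _ 0] by simp
  from choice[OF this] obtain S where
    S: "\<And>f u x. (\<lambda>n. inner_CX f (e n) x * inner_CX (e n) u x) sums inner_CX (S f) u x"
    and S_le: "\<And>f x. sq_norm (S f) x \<le> B * frame_sum f x"
    by blast
  have S_diff: "S (f - h) = S f - S h" for f h
  proof (rule eq_by_inner)
    fix u x
    have "(\<lambda>n. inner_CX (f - h) (e n) x * inner_CX (e n) u x) sums inner_CX (S f - S h) u x"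
      using sums_diff[OF S S, of f x u h] by (simp add: inner_diff_left algebra_simps)
    with S show "inner_CX (S (f - h)) u x = inner_CX (S f - S h) u x"
      by (rule sums_unique2)
  qed
  have S_self: "Re (inner_CX (S f) f x) = frame_sum f x" for f x
  proof -
    have "(\<lambda>n. complex_of_real ((cmod (inner_CX f (e n) x))\<^sup>2)) sums inner_CX (S f) f x"
      using S[of f x f] frame_term[of f _ x] by (simp add: times_bcontfun.rep_eq)
    from sums_unique2[OF sums_Re[OF this]] frame_sums[of f x] show ?thesis
      by simp
  qed
  (* if H is trivial, A may exceed B; the maximum covers this case *)
  define c where "c = max 0 (1 - A / B)"
  have c: "0 \<le> c" "c < 1"
    using A_pos B_pos by (auto simp: c_def)
  define K where "K f = f - (1 / B) *\<^sub>R S f + (1 / B) *\<^sub>R g" for f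
  have "\<exists>!f. K f = f"
  proof (rule banach_fix_type)
    show "0 \<le> sqrt c" "sqrt c < 1"
      using c by simp_all
    show "\<forall>f h. dist (K f) (K h) \<le> sqrt c * dist f h"
    proof (intro allI)
      fix f h :: 'h
      define d where "d = f - h"
      have sq: "sq_norm (d - (1 / B) *\<^sub>R S d) x \<le> c * (norm d)\<^sup>2" for x
      proof -
        have "sq_norm (d - (1 / B) *\<^sub>R S d) x
            = sq_norm d x - 2 * (1 / B) * frame_sum d x + (1 / B)\<^sup>2 * sq_norm (S d) x"
          by (simp add: sq_norm_diff_scaleR S_self)
        also have "(1 / B)\<^sup>2 * sq_norm (S d) x \<le> (1 / B)\<^sup>2 * (B * frame_sum d x)"
          by (intro mult_left_mono S_le) simp
        also have "(1 / B)\<^sup>2 * (B * frame_sum d x) = (1 / B) * frame_sum d x"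
          using B_pos by (simp add: power2_eq_square)
        also have "sq_norm d x - 2 * (1 / B) * frame_sum d x + (1 / B) * frame_sum d x
            = sq_norm d x - (1 / B) * frame_sum d x"
          by simp
        also have "\<dots> \<le> sq_norm d x - (1 / B) * (A * sq_norm d x)"
          using lower_frame_bound[of d x] B_pos by (intro diff_left_mono mult_left_mono) simp_all
        also have "\<dots> = (1 - A / B) * sq_norm d x"
          by (simp add: algebra_simps)
        also have "\<dots> \<le> c * sq_norm d x"
          by (intro mult_right_mono sq_norm_nonneg) (simp add: c_def)
        also have "\<dots> \<le> c * (norm d)\<^sup>2"
          by (intro mult_left_mono sq_norm_le_norm c)
        finally show ?thesis by simp
      qed
      have "norm (d - (1 / B) *\<^sub>R S d) \<le> sqrt c * norm d"
      proof (rule power2_le_imp_le)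
        show "(norm (d - (1 / B) *\<^sub>R S d))\<^sup>2 \<le> (sqrt c * norm d)\<^sup>2"
          using norm_le_of_sq_norm_le[OF sq] c by (simp add: power_mult_distrib)
      qed (use c in simp)
      moreover have "K f - K h = d - (1 / B) *\<^sub>R S d"
        by (simp add: K_def d_def S_diff algebra_simps)
      ultimately show "dist (K f) (K h) \<le> sqrt c * dist f h"
        by (simp add: dist_norm d_def)
    qed
  qed
  then obtain f where "K f = f"
    by blast
  then have "(1 / B) *\<^sub>R (g - S f) = 0"
    by (simp add: K_def algebra_simps)
  then have "S f = g"
    using B_pos by simp
  with S[of f] show ?thesis
    by blast
qed

text \<open>
  The hypothesis says that the range of the analysis map is invariant under the backward shift of
  coefficient sequences. Call \<open>V\<close> the operator on \<open>H\<close> that this shift induces, so that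
  \<open>\<langle>V u, e\<^sub>n\<rangle> = \<langle>u, e\<^sub>n\<^sub>+\<^sub>1\<rangle>\<close>. The operator \<open>T\<close> is the adjoint of \<open>V\<close>; in a Hilbert module its existence
  has to be proved. For \<open>g = S f\<close>, with \<open>S\<close> the frame operator, the vector
  \<open>t = \<Sum>n. \<langle>f, e\<^sub>n\<rangle> e\<^sub>n\<^sub>+\<^sub>1\<close> satisfies
  \<open>\<langle>t, u\<rangle> = \<Sum>n. \<langle>f, e\<^sub>n\<rangle> \<langle>e\<^sub>n, V u\<rangle> = \<langle>g, V u\<rangle>\<close>, hence \<open>T g = t\<close> is the required value. Linearity follows
  from the adjoint relation, the bound from the frame bounds for \<open>V u\<close>, and
  \<open>\<langle>T e\<^sub>n, u\<rangle> = \<langle>e\<^sub>n, V u\<rangle> = \<langle>e\<^sub>n\<^sub>+\<^sub>1, u\<rangle>\<close> for every \<open>u\<close>.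
\<close>

lemma shift_operator_exists:
  assumes shift: "\<And>u. \<exists>v. \<forall>n. inner_CX v (e n) = inner_CX u (e (Suc n))"
  shows "\<exists>T. bounded_operator T \<and> (\<forall>n. T (e n) = e (Suc n))"
proof -
  obtain V where V: "\<And>u n. inner_CX (V u) (e n) = inner_CX u (e (Suc n))"
    using shift by metis
  have "\<exists>t. \<forall>u x. inner_CX t u x = inner_CX g (V u) x" for g
  proof -
    obtain f where f: "\<And>u x. (\<lambda>n. inner_CX f (e n) x * inner_CX (e n) u x) sums inner_CX g u x"
      using frame_operator_surjective by blast
    obtain t where t: "\<And>u x. (\<lambda>n. inner_CX f (e n) x * inner_CX (e (n + 1)) u x) sums inner_CX t u x"
      using synthesis by blast
    have "inner_CX (e (n + 1)) u x = inner_CX (e n) (V u) x" for n u x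
      using inner_commute[of "e (n + 1)" u x] inner_commute[of "e n" "V u" x] by (simp add: V)
    with t have "(\<lambda>n. inner_CX f (e n) x * inner_CX (e n) (V u) x) sums inner_CX t u x" for u x
      by simp
    with f have "inner_CX t u x = inner_CX g (V u) x" for u x
      using sums_unique2 by blast
    then show ?thesis by blast
  qed
  then obtain T where T: "\<And>g u x. inner_CX (T g) u x = inner_CX g (V u) x"
    by metis
  have V_le: "sq_norm (V u) x \<le> B / A * (norm u)\<^sup>2" for u x
  proof -
    have "A * sq_norm (V u) x \<le> frame_sum (V u) x"
      by (rule lower_frame_bound)
    also have "\<dots> = (\<Sum>n. (cmod (inner_CX u (e (Suc n)) x))\<^sup>2)"
      by (simp add: frame_sum_def V)
    also have "\<dots> \<le> frame_sum u x"
      unfolding frame_sum_def using suminf_split_head[OF sums_summable[OF frame_sums[of u x]]] by simp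
    also have "\<dots> \<le> B * (norm u)\<^sup>2"
      using upper_frame_bound sq_norm_le_norm B_pos
      by (meson mult_left_mono order_trans less_imp_le)
    finally show ?thesis
      using A_pos by (simp add: field_simps)
  qed
  have T_bound: "norm (T g) \<le> norm g * sqrt (B / A)" for g
  proof (cases "T g = 0")
    case False
    have BA: "0 \<le> B / A"
      using A_pos B_pos by simp
    have sq: "sq_norm (T g) x \<le> norm g * (sqrt (B / A) * norm (T g))" for x
    proof -
      have "sq_norm (T g) x \<le> cmod (inner_CX g (V (T g)) x)"
        using T[of g "T g" x] complex_Re_le_cmod by (simp add: sq_norm_def)
      also have "\<dots> \<le> norm g * (sqrt (B / A) * norm (T g))"
      proof (rule power2_le_imp_le)
        have "(cmod (inner_CX g (V (T g)) x))\<^sup>2 \<le> sq_norm g x * sq_norm (V (T g)) x"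
          by (rule inner_Cauchy_Schwarz)
        also have "\<dots> \<le> (norm g)\<^sup>2 * (B / A * (norm (T g))\<^sup>2)"
          by (intro mult_mono sq_norm_le_norm V_le sq_norm_nonneg) simp
        finally show "(cmod (inner_CX g (V (T g)) x))\<^sup>2 \<le> (norm g * (sqrt (B / A) * norm (T g)))\<^sup>2"
          using BA by (simp add: power_mult_distrib)
      qed (use BA in simp)
      finally show ?thesis .
    qed
    have "norm (T g) * norm (T g) \<le> (norm g * sqrt (B / A)) * norm (T g)"
      using norm_le_of_sq_norm_le[OF sq] by (simp add: power2_eq_square mult_ac)
    with False show ?thesis
      by (simp add: mult_le_cancel_right)
  qed (use A_pos B_pos in simp)
  have "bounded_linear T"
    by (rule bounded_linear_intro[OF _ _ T_bound]; rule eq_by_inner)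
      (simp_all add: T inner_add_left inner_scaleR_left)
  moreover have "T (scaleC c u) = scaleC c (T u)" for c u
    by (rule eq_by_inner) (simp add: T inner_scaleC_left)
  moreover have "T (e n) = e (Suc n)" for n
  proof (rule eq_by_inner)
    fix u x
    show "inner_CX (T (e n)) u x = inner_CX (e (Suc n)) u x"
      using inner_commute[of "e n" "V u" x] inner_commute[of "e (Suc n)" u x] by (simp add: T V)
  qed
  ultimately show ?thesis
    unfolding bounded_operator_def by blast
qed

end

section \<open>The shift of the frame\<close>

theorem corollary5p3:
  fixes scaleC :: "complex \<Rightarrow> 'h::banach \<Rightarrow> 'h"
    and act :: "('x::t2_space \<Rightarrow>\<^sub>C complex) \<Rightarrow> 'h \<Rightarrow> 'h"
    and inner_CX :: "'h \<Rightarrow> 'h \<Rightarrow> ('x \<Rightarrow>\<^sub>C complex)"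
    and e :: "nat \<Rightarrow> 'h"
    and b :: "'x \<Rightarrow> complex \<Rightarrow> complex"
    and \<mu> :: "'x \<Rightarrow> real measure"
  assumes compact_X: "compact (UNIV :: 'x set)"
    and hilbert: "hilbert_CX_module scaleC act inner_CX"
    and frame: "hilbert_CX_module.standard_frame inner_CX e"
    and image: "range (hilbert_CX_module.analysis_operator inner_CX e) = perp_mult b"
    and b_cases: "\<And>x. (inner_function (b x) \<and> b x 0 = 0) \<or> (\<forall>w\<in>ball 0 1. b x w = 0)"
    and herglotz: "\<And>x. herglotz_measure (b x) (\<mu> x)"
    and weak_cont: "weakly_continuous_family \<mu>"
  shows "\<exists>T. hilbert_CX_module.bounded_operator scaleC T \<and> (\<forall>n. T (e n) = e (Suc n))"
proof -
  interpret hilbert_CX_module scaleC act inner_CX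
    by (rule hilbert)
  obtain A B where "0 < A" "0 < B" and bounds:
    "\<And>f. \<exists>S. (\<lambda>n. inner_CX f (e n) * inner_CX (e n) f) sums S \<and>
     (\<forall>x. complex_of_real A * inner_CX f f x \<le> S x \<and>
          S x \<le> complex_of_real B * inner_CX f f x)"
    using frame unfolding standard_frame_def by blast
  then interpret CX_frame scaleC act inner_CX e A B
    by unfold_locales
  have b_holomorphic: "b x holomorphic_on ball 0 1" for x
    using b_cases[of x]
  proof
    assume "\<forall>w\<in>ball 0 1. b x w = 0"
    then show ?thesis
      using holomorphic_transform[of "\<lambda>_. 0" "ball 0 1" "b x"] by simp
  qed (simp add: inner_function_def)
  have coeffs: "square_summable (\<lambda>n. inner_CX u (e n) x)" for u x
    unfolding square_summable_def using frame_sums by (rule sums_summable)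
  show ?thesis
  proof (rule shift_operator_exists)
    fix u
    have "(\<lambda>x. disk_series (\<lambda>n. inner_CX u (e n) x)) \<in> perp_mult b"
      unfolding image[symmetric] analysis_operator_def by (rule rangeI)
    then have "(\<lambda>x. disk_series (\<lambda>n. inner_CX u (e (Suc n)) x)) \<in> perp_mult b"
      by (rule perp_mult_backward_shift[OF coeffs _ b_holomorphic])
    then obtain v where v: "(\<lambda>x. disk_series (\<lambda>n. inner_CX u (e (Suc n)) x)) = analysis_operator e v"
      unfolding image[symmetric] by (rule rangeE)
    have "(\<lambda>n. inner_CX v (e n) x) = (\<lambda>n. inner_CX u (e (Suc n)) x)" for x
    proof (rule disk_series_inject[OF coeffs])
      show "square_summable (\<lambda>n. inner_CX u (e (Suc n)) x)"
        using coeffs[of u x] square_summable_shift[of "\<lambda>n. inner_CX u (e n) x"] by blast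
      show "disk_series (\<lambda>n. inner_CX v (e n) x) = disk_series (\<lambda>n. inner_CX u (e (Suc n)) x)"
        using fun_cong[OF v, of x] by (simp add: analysis_operator_def)
    qed
    then have "inner_CX v (e n) = inner_CX u (e (Suc n))" for n
      by (intro bcontfun_eqI) (rule fun_cong)
    then show "\<exists>v. \<forall>n. inner_CX v (e n) = inner_CX u (e (Suc n))"
      by blast
  qed
qed

end
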